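(* Let $A$ be an alphabet, and let $G$ and $\Gamma$ be finitely generated groups with $G\leq\Gamma$. For $i=1,2$, let $\mathcal{F}_i$ be a set of patterns on $A$ with supports contained in $G$, let $\mathcal{N}_i$ be a finite nonempty subset of $G$, and let $f_i:A^{\mathcal{N}_i}\to A$. Then $$F^{A,G}_{f_1}\left(\mathsf{X}^{A,G}_{\mathcal{F}_1}\right)\subseteq F^{A,G}_{f_2}\left(\mathsf{X}^{A,G}_{\mathcal{F}_2}\right)$$ if and only if $$F^{A,\Gamma}_{f_1}\left(\mathsf{X}^{A,\Gamma}_{\mathcal{F}_1}\right)\subseteq F^{A,\Gamma}_{f_2}\left(\mathsf{X}^{A,\Gamma}_{\mathcal{F}_2}\right).$$
   Context: An alphabet is a finite set with at least two elements. $G\leq\Gamma$ means that $G$ is a subgroup of $\Gamma$. For a group $H$, $c\in A^H$ and $g\in H$, $c^g\in A^H$ is given by $c^g(h)=c(gh)$. A pattern on $A$ is a map $p:E\to A$ with $E$ finite; $E=\mathrm{supp}\,p$ is its support. If $\mathrm{supp}\,p\subseteq H$, $p$ occurs in $c\in A^H$ if there is $g\in H$ with $c^g|_{\mathrm{supp}\,p}=p$. For a set $\mathcal{F}$ of patterns with supports contained in $H$, $\mathsf{X}^{A,H}_{\mathcal{F}}$ is the set of all $c\in A^H$ in which no $p\in\mathcal{F}$ occurs. For finite $\mathcal{N}\subseteq H$ and $f:A^{\mathcal{N}}\to A$, the map $F^{A,H}_f:A^H\to A^H$ is defined by $(F^{A,H}_f(c))(g)=f(c^g|_{\mathcal{N}})$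 for all $c\in A^H$, $g\in H$. Since $G\le\Gamma$, patterns with support in $G$ and functions $f:A^{\mathcal{N}}\to A$ with $\mathcal{N}\subseteq G$ can be used both with $H=G$ and with $H=\Gamma$. *)

theory Defs
  imports "HOL-Library.FuncSet" "HOL-Algebra.Generated_Groups"
begin

definition alphabet :: "'a set \<Rightarrow> bool" where
  "alphabet A \<longleftrightarrow> finite A \<and> card A \<ge> 2"

definition finitely_generated_group :: "('g, 'm) monoid_scheme \<Rightarrow> bool" where
  "finitely_generated_group H \<longleftrightarrow>
     group H \<and> (\<exists>S. finite S \<and> S \<subseteq> carrier H \<and> generate H S = carrier H)"

text \<open>A set of functions \<open>A\<^sup>E\<close> is rendered as the extensional function space \<open>E \<rightarrow>\<^sub>E A\<close>, so that
  equality of its elements is equality on \<open>E\<close>.\<close>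

definition configurations :: "'a set \<Rightarrow> ('g, 'm) monoid_scheme \<Rightarrow> ('g \<Rightarrow> 'a) set" where
  "configurations A H = carrier H \<rightarrow>\<^sub>E A"

definition shift :: "('g, 'm) monoid_scheme \<Rightarrow> ('g \<Rightarrow> 'a) \<Rightarrow> 'g \<Rightarrow> ('g \<Rightarrow> 'a)" where
  "shift H c g = (\<lambda>h\<in>carrier H. c (g \<otimes>\<^bsub>H\<^esub> h))"

text \<open>The support of a pattern is part of the pattern, and varies within a set of patterns.
  Patterns are therefore partial maps \<open>p\<close>, with support \<open>dom p\<close>; the support may be empty.\<close>

definition patterns :: "'a set \<Rightarrow> 'g set \<Rightarrow> ('g \<rightharpoonup> 'a) set" where
  "patterns A B = {p. finite (dom p) \<and> dom p \<subseteq> B \<and> ran p \<subseteq> A}"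

definition occurs :: "('g, 'm) monoid_scheme \<Rightarrow> ('g \<rightharpoonup> 'a) \<Rightarrow> ('g \<Rightarrow> 'a) \<Rightarrow> bool" where
  "occurs H p c \<longleftrightarrow> (\<exists>g\<in>carrier H. (Some \<circ> shift H c g) |` dom p = p)"

definition subshift ::
  "'a set \<Rightarrow> ('g, 'm) monoid_scheme \<Rightarrow> ('g \<rightharpoonup> 'a) set \<Rightarrow> ('g \<Rightarrow> 'a) set" where
  "subshift A H \<F> = {c \<in> configurations A H. \<forall>p\<in>\<F>. \<not> occurs H p c}"

definition global_map ::
  "('g, 'm) monoid_scheme \<Rightarrow> 'g set \<Rightarrow> (('g \<Rightarrow> 'a) \<Rightarrow> 'a) \<Rightarrow> ('g \<Rightarrow> 'a) \<Rightarrow> ('g \<Rightarrow> 'a)" where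
  "global_map H N f c = (\<lambda>g\<in>carrier H. f (restrict (shift H c g) N))"

end

theory Submission
  imports Defs
begin

text \<open>
  Every pattern and both memory sets lie in \<open>G\<close>, so the subshifts and the global maps over \<open>\<Gamma>\<close>
  never relate two different left cosets \<open>k G\<close>. Translating a left coset back to \<open>G\<close> turns a
  configuration over \<open>\<Gamma>\<close> into a family of configurations over \<open>G\<close>, its \<^emph>\<open>coset traces\<close>. A
  configuration lies in the subshift over \<open>\<Gamma>\<close> exactly when all its traces lie in the subshift over
  \<open>G\<close> (\<open>subshift_iff_coset_traces\<close>), and the global map commutes with taking traces
  (\<open>coset_trace_global_map\<close>). Conversely, once a representative is chosen in each coset, any family
  of configurations over \<open>G\<close> indexed by the representatives is the family of traces of a
  configuration over \<open>\<Gamma>\<close> (\<open>coset_trace_glue\<close>).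

  If the inclusion holds over \<open>G\<close>, preimages under the second map are therefore chosen coset by
  coset and glued. If it holds over \<open>\<Gamma>\<close>, a configuration over \<open>G\<close> is copied to all cosets, a
  preimage of its image is taken over \<open>\<Gamma>\<close>, and that preimage is cut down to a single coset.
\<close>

definition coset_trace ::
  "('g, 'm) monoid_scheme \<Rightarrow> 'g set \<Rightarrow> ('g \<Rightarrow> 'a) \<Rightarrow> 'g \<Rightarrow> ('g \<Rightarrow> 'a)" where
  "coset_trace \<Gamma> G c k = (\<lambda>h\<in>G. c (k \<otimes>\<^bsub>\<Gamma>\<^esub> h))"

text \<open>The last clause makes \<open>r\<close> constant on left cosets, so that its values form a transversal.\<close>

definition coset_representatives :: "('g, 'm) monoid_scheme \<Rightarrow> 'g set \<Rightarrow> ('g \<Rightarrow> 'g) \<Rightarrow> bool" where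
  "coset_representatives \<Gamma> G r \<longleftrightarrow>
     (\<forall>x\<in>carrier \<Gamma>. r x \<in> carrier \<Gamma> \<and> inv\<^bsub>\<Gamma>\<^esub> (r x) \<otimes>\<^bsub>\<Gamma>\<^esub> x \<in> G
        \<and> (\<forall>h\<in>G. r (x \<otimes>\<^bsub>\<Gamma>\<^esub> h) = r x))"

definition glue ::
  "('g, 'm) monoid_scheme \<Rightarrow> ('g \<Rightarrow> 'g) \<Rightarrow> ('g \<Rightarrow> 'g \<Rightarrow> 'a) \<Rightarrow> ('g \<Rightarrow> 'a)" where
  "glue \<Gamma> r e = (\<lambda>x\<in>carrier \<Gamma>. e (r x) (inv\<^bsub>\<Gamma>\<^esub> (r x) \<otimes>\<^bsub>\<Gamma>\<^esub> x))"

section \<open>Coset traces\<close>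

lemma shift_subgroup:
  "shift (\<Gamma>\<lparr>carrier := G\<rparr>) c g = coset_trace \<Gamma> G c g"
  by (simp add: shift_def coset_trace_def)

lemma coset_trace_coset_trace:
  assumes "group \<Gamma>" and "subgroup G \<Gamma>" and "k \<in> carrier \<Gamma>" and "g \<in> G"
  shows "coset_trace \<Gamma> G (coset_trace \<Gamma> G c k) g = coset_trace \<Gamma> G c (k \<otimes>\<^bsub>\<Gamma>\<^esub> g)"
proof -
  interpret group \<Gamma> by fact
  show ?thesis
    using assms by (auto simp: coset_trace_def subgroup.m_closed subgroup.mem_carrier m_assoc)
qed

lemma coset_trace_in_configurations:
  assumes "group \<Gamma>" and "subgroup G \<Gamma>" and "c \<in> configurations A \<Gamma>" and "k \<in> carrier \<Gamma>"
  shows "coset_trace \<Gamma> G c k \<in> configurations A (\<Gamma>\<lparr>carrier := G\<rparr>)"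
proof -
  interpret group \<Gamma> by fact
  interpret subgroup G \<Gamma> by fact
  have "c (k \<otimes>\<^bsub>\<Gamma>\<^esub> h) \<in> A" if "h \<in> G" for h
    using assms(3,4) that by (auto simp: configurations_def)
  then show ?thesis
    by (simp add: coset_trace_def configurations_def)
qed

lemma coset_trace_one:
  assumes "group \<Gamma>" and "subgroup G \<Gamma>" and "c \<in> configurations A (\<Gamma>\<lparr>carrier := G\<rparr>)"
  shows "coset_trace \<Gamma> G c \<one>\<^bsub>\<Gamma>\<^esub> = c"
proof -
  interpret group \<Gamma> by fact
  show ?thesis
  proof
    fix h
    show "coset_trace \<Gamma> G c \<one>\<^bsub>\<Gamma>\<^esub> h = c h"
      using assms
      by (cases "h \<in> G")
        (auto simp: coset_trace_def configurations_def subgroup.mem_carrier PiE_def extensional_def)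
  qed
qed

text \<open>One trace per coset determines a configuration, since every \<open>x\<close> equals \<open>r x\<close> times an
  element of \<open>G\<close>.\<close>

lemma configurations_eqI_coset_traces:
  assumes "group \<Gamma>" and "coset_representatives \<Gamma> G r"
    and "c \<in> extensional (carrier \<Gamma>)" and "d \<in> extensional (carrier \<Gamma>)"
    and "\<And>x. x \<in> carrier \<Gamma> \<Longrightarrow> coset_trace \<Gamma> G c (r x) = coset_trace \<Gamma> G d (r x)"
  shows "c = d"
proof (rule extensionalityI[OF assms(3,4)])
  interpret group \<Gamma> by fact
  fix x assume x: "x \<in> carrier \<Gamma>"
  let ?h = "inv\<^bsub>\<Gamma>\<^esub> (r x) \<otimes>\<^bsub>\<Gamma>\<^esub> x"
  have r: "r x \<in> carrier \<Gamma>" and h: "?h \<in> G"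
    using assms(2) x by (auto simp: coset_representatives_def)
  have "r x \<otimes>\<^bsub>\<Gamma>\<^esub> ?h = x"
    using x r by (simp add: m_assoc[symmetric])
  then show "c x = d x"
    using fun_cong[OF assms(5)[OF x], of ?h] h by (simp add: coset_trace_def)
qed

section \<open>Subshifts and global maps act on each coset separately\<close>

text \<open>Reading a pattern with support in \<open>G\<close> at the position \<open>g\<close> uses only the values on the coset
  \<open>g G\<close>, and these form the trace at \<open>g\<close>.\<close>

lemma occurs_iff_coset_trace:
  assumes "subgroup G \<Gamma>" and "dom p \<subseteq> G"
  shows "occurs \<Gamma> p c \<longleftrightarrow> (\<exists>g\<in>carrier \<Gamma>. (Some \<circ> coset_trace \<Gamma> G c g) |` dom p = p)"
proof -
  have "(Some \<circ> shift \<Gamma> c g) |` dom p = (Some \<circ> coset_trace \<Gamma> G c g) |` dom p" for g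
    using assms subgroup.subset[OF assms(1)]
    by (auto simp: fun_eq_iff restrict_map_def shift_def coset_trace_def)
  then show ?thesis by (simp add: occurs_def)
qed

lemma occurs_subgroup_iff_coset_trace:
  "occurs (\<Gamma>\<lparr>carrier := G\<rparr>) p c \<longleftrightarrow> (\<exists>g\<in>G. (Some \<circ> coset_trace \<Gamma> G c g) |` dom p = p)"
  by (simp add: occurs_def shift_subgroup)

text \<open>The trace at \<open>k\<close>, read at \<open>g \<in> G\<close>, shows what the configuration shows at \<open>k g\<close>; and the
  products \<open>k g\<close> exhaust \<open>\<Gamma>\<close>, already with \<open>g = \<one>\<close>.\<close>

lemma occurs_iff_occurs_in_coset_trace:
  assumes "group \<Gamma>" and "subgroup G \<Gamma>" and "dom p \<subseteq> G"
  shows "occurs \<Gamma> p c \<longleftrightarrow> (\<exists>k\<in>carrier \<Gamma>. occurs (\<Gamma>\<lparr>carrier := G\<rparr>) p (coset_trace \<Gamma> G c k))"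
proof -
  interpret group \<Gamma> by fact
  interpret subgroup G \<Gamma> by fact
  let ?at = "\<lambda>g. (Some \<circ> coset_trace \<Gamma> G c g) |` dom p = p"
  have trace: "occurs (\<Gamma>\<lparr>carrier := G\<rparr>) p (coset_trace \<Gamma> G c k) \<longleftrightarrow> (\<exists>g\<in>G. ?at (k \<otimes>\<^bsub>\<Gamma>\<^esub> g))"
    if "k \<in> carrier \<Gamma>" for k
    using that assms by (simp add: occurs_subgroup_iff_coset_trace coset_trace_coset_trace)
  have "(\<exists>k\<in>carrier \<Gamma>. ?at k) \<longleftrightarrow> (\<exists>k\<in>carrier \<Gamma>. \<exists>g\<in>G. ?at (k \<otimes>\<^bsub>\<Gamma>\<^esub> g))"
  proof
    assume "\<exists>k\<in>carrier \<Gamma>. ?at k"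
    then obtain k where k: "k \<in> carrier \<Gamma>" "?at (k \<otimes>\<^bsub>\<Gamma>\<^esub> \<one>\<^bsub>\<Gamma>\<^esub>)"
      by auto
    show "\<exists>k\<in>carrier \<Gamma>. \<exists>g\<in>G. ?at (k \<otimes>\<^bsub>\<Gamma>\<^esub> g)"
      by (intro bexI[of _ k] bexI[of _ "\<one>\<^bsub>\<Gamma>\<^esub>"] k one_closed)
  next
    assume "\<exists>k\<in>carrier \<Gamma>. \<exists>g\<in>G. ?at (k \<otimes>\<^bsub>\<Gamma>\<^esub> g)"
    then obtain k g where "k \<in> carrier \<Gamma>" "g \<in> G" and at: "?at (k \<otimes>\<^bsub>\<Gamma>\<^esub> g)"
      by blast
    then have "k \<otimes>\<^bsub>\<Gamma>\<^esub> g \<in> carrier \<Gamma>"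
      by simp
    with at show "\<exists>k\<in>carrier \<Gamma>. ?at k"
      by (rule bexI)
  qed
  then show ?thesis
    unfolding occurs_iff_coset_trace[OF assms(2,3)] by (simp add: trace)
qed

lemma subshift_iff_coset_traces:
  assumes "group \<Gamma>" and "subgroup G \<Gamma>" and "\<F> \<subseteq> patterns A G" and "c \<in> configurations A \<Gamma>"
  shows "c \<in> subshift A \<Gamma> \<F> \<longleftrightarrow>
    (\<forall>k\<in>carrier \<Gamma>. coset_trace \<Gamma> G c k \<in> subshift A (\<Gamma>\<lparr>carrier := G\<rparr>) \<F>)"
proof -
  have "dom p \<subseteq> G" if "p \<in> \<F>" for p
    using assms(3) that by (auto simp: patterns_def)
  then have "occurs \<Gamma> p c \<longleftrightarrow>
      (\<exists>k\<in>carrier \<Gamma>. occurs (\<Gamma>\<lparr>carrier := G\<rparr>) p (coset_trace \<Gamma> G c k))" if "p \<in> \<F>" for p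
    by (rule occurs_iff_occurs_in_coset_trace[OF assms(1,2)]) (use that in blast)
  then show ?thesis
    using assms(4) coset_trace_in_configurations[OF assms(1,2,4)] unfolding subshift_def by blast
qed

lemma subshift_shift_invariant:
  assumes "group \<Gamma>" and "subgroup G \<Gamma>"
    and "c \<in> subshift A (\<Gamma>\<lparr>carrier := G\<rparr>) \<F>" and "g \<in> G"
  shows "coset_trace \<Gamma> G c g \<in> subshift A (\<Gamma>\<lparr>carrier := G\<rparr>) \<F>"
proof -
  interpret group \<Gamma> by fact
  interpret subgroup G \<Gamma> by fact
  have "occurs (\<Gamma>\<lparr>carrier := G\<rparr>) p c"
    if occ: "occurs (\<Gamma>\<lparr>carrier := G\<rparr>) p (coset_trace \<Gamma> G c g)" for p
  proof -
    obtain h where h: "h \<in> G"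
      and "(Some \<circ> coset_trace \<Gamma> G (coset_trace \<Gamma> G c g) h) |` dom p = p"
      using occ unfolding occurs_subgroup_iff_coset_trace by blast
    then have "(Some \<circ> coset_trace \<Gamma> G c (g \<otimes>\<^bsub>\<Gamma>\<^esub> h)) |` dom p = p"
      by (simp only: coset_trace_coset_trace[OF assms(1,2) mem_carrier[OF assms(4)] h])
    moreover have "g \<otimes>\<^bsub>\<Gamma>\<^esub> h \<in> G"
      using assms(4) h by simp
    ultimately show ?thesis
      unfolding occurs_subgroup_iff_coset_trace by blast
  qed
  moreover have "coset_trace \<Gamma> G c g \<in> configurations A (\<Gamma>\<lparr>carrier := G\<rparr>)"
    using assms(3,4) by (auto simp: subshift_def configurations_def coset_trace_def)
  ultimately show ?thesis
    using assms(3) by (auto simp: subshift_def)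
qed

text \<open>The value of the global map at \<open>k h\<close> with \<open>h \<in> G\<close> depends only on the configuration on
  \<open>k h N\<close>, which stays inside the coset \<open>k G\<close> because \<open>N \<subseteq> G\<close>.\<close>

lemma coset_trace_global_map:
  assumes "group \<Gamma>" and "subgroup G \<Gamma>" and "N \<subseteq> G" and "k \<in> carrier \<Gamma>"
  shows "coset_trace \<Gamma> G (global_map \<Gamma> N f c) k
    = global_map (\<Gamma>\<lparr>carrier := G\<rparr>) N f (coset_trace \<Gamma> G c k)"
proof
  interpret group \<Gamma> by fact
  interpret subgroup G \<Gamma> by fact
  fix h
  have "restrict (shift \<Gamma> c (k \<otimes>\<^bsub>\<Gamma>\<^esub> h)) N = restrict (coset_trace \<Gamma> G c (k \<otimes>\<^bsub>\<Gamma>\<^esub> h)) N"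
    using assms(3) by (auto simp: shift_def coset_trace_def restrict_def fun_eq_iff)
  then show "coset_trace \<Gamma> G (global_map \<Gamma> N f c) k h
      = global_map (\<Gamma>\<lparr>carrier := G\<rparr>) N f (coset_trace \<Gamma> G c k) h"
    using assms
    by (simp add: global_map_def shift_subgroup coset_trace_coset_trace)
      (simp add: coset_trace_def)
qed

section \<open>Gluing configurations along coset representatives\<close>

lemma ex_coset_representatives:
  assumes "group \<Gamma>" and "subgroup G \<Gamma>"
  obtains r where "coset_representatives \<Gamma> G r"
proof -
  interpret group \<Gamma> by fact
  interpret subgroup G \<Gamma> by fact
  define r where "r x = (SOME y. y \<in> x <#\<^bsub>\<Gamma>\<^esub> G)" for x
  have r: "r x \<in> x <#\<^bsub>\<Gamma>\<^esub> G" if "x \<in> carrier \<Gamma>" for x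
    unfolding r_def
  proof (rule someI)
    show "x \<in> x <#\<^bsub>\<Gamma>\<^esub> G"
      using that by (auto simp: l_coset_def intro!: bexI[of _ "\<one>\<^bsub>\<Gamma>\<^esub>"])
  qed
  have "coset_representatives \<Gamma> G r"
    unfolding coset_representatives_def
  proof (intro ballI conjI)
    fix x assume x: "x \<in> carrier \<Gamma>"
    obtain h where h: "h \<in> G" "r x = x \<otimes>\<^bsub>\<Gamma>\<^esub> h"
      using r[OF x] by (auto simp: l_coset_def)
    show "r x \<in> carrier \<Gamma>"
      using h x by simp
    have "inv\<^bsub>\<Gamma>\<^esub> (r x) \<otimes>\<^bsub>\<Gamma>\<^esub> x = inv\<^bsub>\<Gamma>\<^esub> h"
      using h x by (simp add: inv_mult_group m_assoc)
    then show "inv\<^bsub>\<Gamma>\<^esub> (r x) \<otimes>\<^bsub>\<Gamma>\<^esub> x \<in> G"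
      using h by simp
    fix g assume g: "g \<in> G"
    have "x \<otimes>\<^bsub>\<Gamma>\<^esub> g \<in> x <#\<^bsub>\<Gamma>\<^esub> G"
      using g by (auto simp: l_coset_def)
    then have "(x \<otimes>\<^bsub>\<Gamma>\<^esub> g) <#\<^bsub>\<Gamma>\<^esub> G = x <#\<^bsub>\<Gamma>\<^esub> G"
      using l_repr_independence x assms(2) by metis
    then show "r (x \<otimes>\<^bsub>\<Gamma>\<^esub> g) = r x"
      by (simp add: r_def)
  qed
  then show thesis by (rule that)
qed

text \<open>Away from the representative of its coset, a trace of the glued configuration is still a
  \<open>G\<close>-translate of the chosen member of the family; since subshifts are translation invariant,
  this is enough to place the glued configuration in a subshift.\<close>

lemma coset_trace_glue:
  assumes "group \<Gamma>" and "subgroup G \<Gamma>" and "coset_representatives \<Gamma> G r" and "k \<in> carrier \<Gamma>"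
  shows "coset_trace \<Gamma> G (glue \<Gamma> r e) k
    = coset_trace \<Gamma> G (e (r k)) (inv\<^bsub>\<Gamma>\<^esub> (r k) \<otimes>\<^bsub>\<Gamma>\<^esub> k)"
proof -
  interpret group \<Gamma> by fact
  interpret subgroup G \<Gamma> by fact
  show ?thesis
    using assms(3,4)
    by (auto simp: coset_trace_def glue_def coset_representatives_def m_assoc fun_eq_iff)
qed

text \<open>At a representative the translation in \<open>coset_trace_glue\<close> is trivial, because \<open>r\<close> is
  idempotent: \<open>r x\<close> lies in the coset of \<open>x\<close>.\<close>

lemma coset_trace_glue_representative:
  assumes "group \<Gamma>" and "subgroup G \<Gamma>" and "coset_representatives \<Gamma> G r" and "x \<in> carrier \<Gamma>"
    and "e (r x) \<in> configurations A (\<Gamma>\<lparr>carrier := G\<rparr>)"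
  shows "coset_trace \<Gamma> G (glue \<Gamma> r e) (r x) = e (r x)"
proof -
  interpret group \<Gamma> by fact
  interpret subgroup G \<Gamma> by fact
  have rx: "r x \<in> carrier \<Gamma>" and h: "inv\<^bsub>\<Gamma>\<^esub> (r x) \<otimes>\<^bsub>\<Gamma>\<^esub> x \<in> G"
    and const: "\<And>h. h \<in> G \<Longrightarrow> r (x \<otimes>\<^bsub>\<Gamma>\<^esub> h) = r x"
    using assms(3,4) by (auto simp: coset_representatives_def)
  have "r x = x \<otimes>\<^bsub>\<Gamma>\<^esub> inv\<^bsub>\<Gamma>\<^esub> (inv\<^bsub>\<Gamma>\<^esub> (r x) \<otimes>\<^bsub>\<Gamma>\<^esub> x)"
    using assms(4) rx by (simp add: inv_mult_group m_assoc[symmetric])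
  then have "r (r x) = r x"
    using const h by (metis m_inv_closed)
  then show ?thesis
    using coset_trace_glue[OF assms(1-3) rx, of e] rx coset_trace_one[OF assms(1,2,5)] by simp
qed

lemma glue_in_subshift:
  assumes "group \<Gamma>" and "subgroup G \<Gamma>" and "coset_representatives \<Gamma> G r"
    and "\<F> \<subseteq> patterns A G"
    and "\<And>x. x \<in> carrier \<Gamma> \<Longrightarrow> e (r x) \<in> subshift A (\<Gamma>\<lparr>carrier := G\<rparr>) \<F>"
  shows "glue \<Gamma> r e \<in> subshift A \<Gamma> \<F>"
proof -
  have h: "inv\<^bsub>\<Gamma>\<^esub> (r x) \<otimes>\<^bsub>\<Gamma>\<^esub> x \<in> G" if "x \<in> carrier \<Gamma>" for x
    using assms(3) that by (auto simp: coset_representatives_def)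
  have "e (r x) (inv\<^bsub>\<Gamma>\<^esub> (r x) \<otimes>\<^bsub>\<Gamma>\<^esub> x) \<in> A" if "x \<in> carrier \<Gamma>" for x
    using assms(5)[OF that] h[OF that] by (auto simp: subshift_def configurations_def)
  then have "glue \<Gamma> r e \<in> configurations A \<Gamma>"
    by (auto simp: glue_def configurations_def)
  moreover have "coset_trace \<Gamma> G (glue \<Gamma> r e) k \<in> subshift A (\<Gamma>\<lparr>carrier := G\<rparr>) \<F>"
    if "k \<in> carrier \<Gamma>" for k
    unfolding coset_trace_glue[OF assms(1-3) that]
    by (rule subshift_shift_invariant[OF assms(1,2) assms(5)[OF that] h[OF that]])
  ultimately show ?thesis
    using subshift_iff_coset_traces[OF assms(1,2,4)] by blast
qed

section \<open>Transfer of the inclusion between subgroup and group\<close>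

theorem lemma1:
  fixes A :: "'a set"
    and \<Gamma> :: "('g, 'm) monoid_scheme"
    and G :: "'g set"
    and \<F>\<^sub>1 \<F>\<^sub>2 :: "('g \<rightharpoonup> 'a) set"
    and N\<^sub>1 N\<^sub>2 :: "'g set"
    and f\<^sub>1 f\<^sub>2 :: "('g \<Rightarrow> 'a) \<Rightarrow> 'a"
  assumes "alphabet A"
    and "finitely_generated_group \<Gamma>"
    and "subgroup G \<Gamma>"
    and "finitely_generated_group (\<Gamma>\<lparr>carrier := G\<rparr>)"
    and "\<F>\<^sub>1 \<subseteq> patterns A G" and "\<F>\<^sub>2 \<subseteq> patterns A G"
    and "finite N\<^sub>1" and "N\<^sub>1 \<noteq> {}" and "N\<^sub>1 \<subseteq> G"
    and "finite N\<^sub>2" and "N\<^sub>2 \<noteq> {}" and "N\<^sub>2 \<subseteq> G"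
    and "f\<^sub>1 \<in> (N\<^sub>1 \<rightarrow>\<^sub>E A) \<rightarrow> A" and "f\<^sub>2 \<in> (N\<^sub>2 \<rightarrow>\<^sub>E A) \<rightarrow> A"
  shows "global_map (\<Gamma>\<lparr>carrier := G\<rparr>) N\<^sub>1 f\<^sub>1 ` subshift A (\<Gamma>\<lparr>carrier := G\<rparr>) \<F>\<^sub>1
           \<subseteq> global_map (\<Gamma>\<lparr>carrier := G\<rparr>) N\<^sub>2 f\<^sub>2 ` subshift A (\<Gamma>\<lparr>carrier := G\<rparr>) \<F>\<^sub>2
         \<longleftrightarrow>
         global_map \<Gamma> N\<^sub>1 f\<^sub>1 ` subshift A \<Gamma> \<F>\<^sub>1
           \<subseteq> global_map \<Gamma> N\<^sub>2 f\<^sub>2 ` subshift A \<Gamma> \<F>\<^sub>2"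
proof -
  let ?H = "\<Gamma>\<lparr>carrier := G\<rparr>"
  have grp: "group \<Gamma>"
    using assms(2) by (simp add: finitely_generated_group_def)
  note sub = \<open>subgroup G \<Gamma>\<close>
  obtain r where r: "coset_representatives \<Gamma> G r"
    by (rule ex_coset_representatives[OF grp sub])
  have r_carrier: "r x \<in> carrier \<Gamma>" if "x \<in> carrier \<Gamma>" for x
    using r that by (simp add: coset_representatives_def)
  note trace_subshift1 = subshift_iff_coset_traces[OF grp sub \<open>\<F>\<^sub>1 \<subseteq> patterns A G\<close>]
  note trace_subshift2 = subshift_iff_coset_traces[OF grp sub \<open>\<F>\<^sub>2 \<subseteq> patterns A G\<close>]
  note trace_map1 = coset_trace_global_map[OF grp sub \<open>N\<^sub>1 \<subseteq> G\<close>]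
  note trace_map2 = coset_trace_global_map[OF grp sub \<open>N\<^sub>2 \<subseteq> G\<close>]
  note trace_glue = coset_trace_glue_representative[OF grp sub r]
  show ?thesis
  proof
    assume incl: "global_map ?H N\<^sub>1 f\<^sub>1 ` subshift A ?H \<F>\<^sub>1 \<subseteq> global_map ?H N\<^sub>2 f\<^sub>2 ` subshift A ?H \<F>\<^sub>2"
    show "global_map \<Gamma> N\<^sub>1 f\<^sub>1 ` subshift A \<Gamma> \<F>\<^sub>1 \<subseteq> global_map \<Gamma> N\<^sub>2 f\<^sub>2 ` subshift A \<Gamma> \<F>\<^sub>2"
    proof (rule image_subsetI)
      fix c assume c: "c \<in> subshift A \<Gamma> \<F>\<^sub>1"
      then have "coset_trace \<Gamma> G c k \<in> subshift A ?H \<F>\<^sub>1" if "k \<in> carrier \<Gamma>" for k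
        using trace_subshift1 that by (auto simp: subshift_def)
      then have "\<forall>k\<in>carrier \<Gamma>. \<exists>d\<in>subshift A ?H \<F>\<^sub>2.
          global_map ?H N\<^sub>1 f\<^sub>1 (coset_trace \<Gamma> G c k) = global_map ?H N\<^sub>2 f\<^sub>2 d"
        using incl by blast
      then obtain e where e_mem: "\<And>k. k \<in> carrier \<Gamma> \<Longrightarrow> e k \<in> subshift A ?H \<F>\<^sub>2"
        and e_map: "\<And>k. k \<in> carrier \<Gamma> \<Longrightarrow>
          global_map ?H N\<^sub>1 f\<^sub>1 (coset_trace \<Gamma> G c k) = global_map ?H N\<^sub>2 f\<^sub>2 (e k)"
        by metis
      let ?d = "glue \<Gamma> r e"
      have "?d \<in> subshift A \<Gamma> \<F>\<^sub>2"
        by (rule glue_in_subshift[OF grp sub r \<open>\<F>\<^sub>2 \<subseteq> patterns A G\<close>]) (simp add: e_mem r_carrier)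
      moreover have "global_map \<Gamma> N\<^sub>1 f\<^sub>1 c = global_map \<Gamma> N\<^sub>2 f\<^sub>2 ?d"
      proof (rule configurations_eqI_coset_traces[OF grp r])
        fix x assume x: "x \<in> carrier \<Gamma>"
        have "coset_trace \<Gamma> G ?d (r x) = e (r x)"
          using trace_glue[OF x, of e A] e_mem[OF r_carrier[OF x]] by (simp add: subshift_def)
        then show "coset_trace \<Gamma> G (global_map \<Gamma> N\<^sub>1 f\<^sub>1 c) (r x)
            = coset_trace \<Gamma> G (global_map \<Gamma> N\<^sub>2 f\<^sub>2 ?d) (r x)"
          using e_map r_carrier[OF x] by (simp add: trace_map1 trace_map2)
      qed (simp_all add: global_map_def)
      ultimately show "global_map \<Gamma> N\<^sub>1 f\<^sub>1 c \<in> global_map \<Gamma> N\<^sub>2 f\<^sub>2 ` subshift A \<Gamma> \<F>\<^sub>2"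
        by blast
    qed
  next
    assume incl: "global_map \<Gamma> N\<^sub>1 f\<^sub>1 ` subshift A \<Gamma> \<F>\<^sub>1 \<subseteq> global_map \<Gamma> N\<^sub>2 f\<^sub>2 ` subshift A \<Gamma> \<F>\<^sub>2"
    show "global_map ?H N\<^sub>1 f\<^sub>1 ` subshift A ?H \<F>\<^sub>1 \<subseteq> global_map ?H N\<^sub>2 f\<^sub>2 ` subshift A ?H \<F>\<^sub>2"
    proof (rule image_subsetI)
      fix c assume c: "c \<in> subshift A ?H \<F>\<^sub>1"
      let ?c = "glue \<Gamma> r (\<lambda>_. c)"
      \<comment> \<open>Any coset would do for cutting down, but the trace has to be taken at its representative,
        the place where the copy of \<open>c\<close> reappears untranslated.\<close>
      let ?k = "r \<one>\<^bsub>\<Gamma>\<^esub>"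
      have one: "\<one>\<^bsub>\<Gamma>\<^esub> \<in> carrier \<Gamma>"
        using grp by (simp add: group.is_monoid)
      note k = r_carrier[OF one]
      have "?c \<in> subshift A \<Gamma> \<F>\<^sub>1"
        by (rule glue_in_subshift[OF grp sub r \<open>\<F>\<^sub>1 \<subseteq> patterns A G\<close>]) (rule c)
      then obtain d where d: "d \<in> subshift A \<Gamma> \<F>\<^sub>2"
        and eq: "global_map \<Gamma> N\<^sub>1 f\<^sub>1 ?c = global_map \<Gamma> N\<^sub>2 f\<^sub>2 d"
        using incl by blast
      have "coset_trace \<Gamma> G ?c ?k = c"
        using trace_glue[OF one, of "\<lambda>_. c" A] c by (simp add: subshift_def)
      then have "global_map ?H N\<^sub>1 f\<^sub>1 c = global_map ?H N\<^sub>2 f\<^sub>2 (coset_trace \<Gamma> G d ?k)"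
        using arg_cong[OF eq, of "\<lambda>z. coset_trace \<Gamma> G z ?k"] k
        by (simp add: trace_map1 trace_map2)
      moreover have "coset_trace \<Gamma> G d ?k \<in> subshift A ?H \<F>\<^sub>2"
        using d trace_subshift2 k by (auto simp: subshift_def)
      ultimately show "global_map ?H N\<^sub>1 f\<^sub>1 c \<in> global_map ?H N\<^sub>2 f\<^sub>2 ` subshift A ?H \<F>\<^sub>2"
        by blast
    qed
  qed
qed

end
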